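(* For each integer $n\ge 1$ let $V_n:\{0,1,\dots,n\}\to\mathbb R$ be a function such that the finite sequence $\{V_n(r)\}_{r=0}^n$ is unimodal. Let $\Delta_n(r)=V_n(r)-V_n(r-1)$ and $D_n(r)=k_n\Delta_n(r)$ for $r\in\{1,\dots,n\}$, where $k_n>0$ for every $n$, and let $\ell\in(0,1)$. Suppose that $U\subset\mathbb R$ is an open interval, $g:U\to\mathbb R$ is continuous, and $D_n(\ell n+u)\to g(u)$ as $n\to\infty$ locally uniformly on $U$ over admissible integer arguments, i.e. for every compact $K\subset U$, $$\sup_{\substack{u\in K\\ \ell n+u\in\{1,\dots,n\}}}|D_n(\ell n+u)-g(u)|\longrightarrow0 .$$ Let $(p_j,q_j)$ be a sequence of integer pairs with $q_j\to\infty$ and $p_j-\ell q_j\to s$ for some $s\in\mathbb R$. If $h\in\mathbb Z$ satisfies $$s+h,\ s+h+1\in U,\qquad g(s+h)>0>g(s+h+1),$$ then for all sufficiently large $j$, $p_j+h$ is the unique maximizer of $V_{q_j}$ over $\{0,1,\dots,q_j\}$.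
   Context: A finite real sequence $\{V(r)\}_{r=0}^n$ is unimodal if there exist $0\le a\le b\le n$ with $V(0)\le\cdots\le V(a)=\cdots=V(b)\ge\cdots\ge V(n)$. The supremum over an empty set is taken to be $0$. *)

theory Defs
  imports "HOL-Analysis.Analysis"
begin

text \<open>
  A family of finite sequences \<open>{V\<^sub>n(r)}\<close>, \<open>0 \<le> r \<le> n\<close>, is a function \<open>V :: int \<Rightarrow> int \<Rightarrow> real\<close>; only
  the values \<open>V n r\<close> with \<open>1 \<le> n\<close> and \<open>0 \<le> r \<le> n\<close> are meaningful. Integers rather than naturals
  are used as indices so that subtraction is not truncated.
\<close>

definition unimodal_upto :: "int \<Rightarrow> (int \<Rightarrow> real) \<Rightarrow> bool" where
  "unimodal_upto n f \<longleftrightarrow>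
     (\<exists>a b. 0 \<le> a \<and> a \<le> b \<and> b \<le> n \<and>
        (\<forall>r\<in>{0..<a}. f r \<le> f (r + 1)) \<and>
        (\<forall>r\<in>{a..<b}. f r = f (r + 1)) \<and>
        (\<forall>r\<in>{b..<n}. f r \<ge> f (r + 1)))"

definition Delta :: "(int \<Rightarrow> int \<Rightarrow> real) \<Rightarrow> int \<Rightarrow> int \<Rightarrow> real" where
  "Delta V n r = V n r - V n (r - 1)"

definition scaled_Delta :: "(int \<Rightarrow> real) \<Rightarrow> (int \<Rightarrow> int \<Rightarrow> real) \<Rightarrow> int \<Rightarrow> int \<Rightarrow> real" where
  "scaled_Delta k V n r = k n * Delta V n r"

text \<open>The supremum of the empty set is taken to be 0; on \<open>real\<close>, \<open>Sup {}\<close> does not have this value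
  by definition.\<close>

definition Sup0 :: "real set \<Rightarrow> real" where
  "Sup0 S = (if S = {} then 0 else Sup S)"

text \<open>In \<open>sup_deviation\<close> the integer \<open>r\<close> is the admissible argument \<open>l * n + u\<close>. For compact \<open>K\<close> the
  set of deviations is finite, so its \<open>Sup\<close> is a genuine supremum.\<close>

definition sup_deviation ::
  "(int \<Rightarrow> int \<Rightarrow> real) \<Rightarrow> real \<Rightarrow> (real \<Rightarrow> real) \<Rightarrow> real set \<Rightarrow> int \<Rightarrow> real" where
  "sup_deviation D l g K n =
     Sup0 {\<bar>D n r - g u\<bar> | u r. u \<in> K \<and> r \<in> {1..n} \<and> l * real_of_int n + u = real_of_int r}"

definition locally_uniform_lattice_limit ::
  "(int \<Rightarrow> int \<Rightarrow> real) \<Rightarrow> real \<Rightarrow> (real \<Rightarrow> real) \<Rightarrow> real set \<Rightarrow> bool" where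
  "locally_uniform_lattice_limit D l g U \<longleftrightarrow>
     (\<forall>K. compact K \<and> K \<subseteq> U \<longrightarrow> (sup_deviation D l g K \<longlongrightarrow> 0) at_top)"

end

(* Along any integers r(j) with r(j) - l q(j) convergent to a point x of U, the scaled
   differences tend to g x. So V(q j) strictly rises into p j + h and strictly falls after it,
   and a unimodal sequence has a unique maximizer at such a strict local maximum. *)
theory Submission
  imports Defs
begin

text \<open>The strict rise into \<open>m\<close> can lie neither on the plateau nor on the descent,
  so \<open>m - 1 < a\<close>. The strict fall after \<open>m\<close> can lie neither on the ascent
  nor on the plateau, so \<open>b \<le> m\<close>. Since \<open>a \<le> b\<close>, the plateau
  collapses to the single point \<open>m\<close>.\<close>

lemma unimodal_upto_strict_local_max_unique:
  assumes uni: "unimodal_upto n f"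
    and m: "1 \<le> m" "m < n"
    and up: "f (m - 1) < f m"
    and down: "f (m + 1) < f m"
  shows "{r. is_arg_max f (\<lambda>r. r \<in> {0..n}) r} = {m}"
proof -
  obtain a b where ab: "a \<le> b"
    and inc: "\<And>r. 0 \<le> r \<Longrightarrow> r < a \<Longrightarrow> f r \<le> f (r + 1)"
    and eq: "\<And>r. a \<le> r \<Longrightarrow> r < b \<Longrightarrow> f r = f (r + 1)"
    and dec: "\<And>r. b \<le> r \<Longrightarrow> r < n \<Longrightarrow> f (r + 1) \<le> f r"
    using uni unfolding unimodal_upto_def by fastforce
  have "m - 1 < a"
    using eq[of "m - 1"] dec[of "m - 1"] up m by fastforce
  moreover have "b \<le> m"
    using inc[of m] eq[of m] down m by fastforce
  ultimately have am: "a = m" and bm: "b = m"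
    using ab by linarith+
  \<comment> \<open>The comparison is with the neighbour of \<open>m\<close>, since monotonicity is
    only weak: strictness comes from \<open>up\<close> alone. The guard \<open>0 \<le> r\<close>
    sits inside the induction formula because the downward induction runs past 0, where nothing is
    known about \<open>f\<close>. \<open>right\<close> is the mirror image.\<close>
  have left: "0 \<le> r \<longrightarrow> f r \<le> f (m - 1)" if "r \<le> m - 1" for r
    using that
  proof (induction r rule: int_le_induct)
    case base
    show ?case by simp
  next
    case (step i)
    show ?case using inc[of "i - 1"] step am by fastforce
  qed
  have right: "r \<le> n \<longrightarrow> f r \<le> f (m + 1)" if "m + 1 \<le> r" for r
    using that
  proof (induction r rule: int_ge_induct)
    case base
    show ?case by simp
  next
    case (step i)
    show ?case using dec[of i] step bm by fastforce
  qed
  have less: "f r < f m" if "r \<in> {0..n}" "r \<noteq> m" for r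
  proof (cases "r < m")
    case True
    then show ?thesis using left[of r] up that by simp
  next
    case False
    then show ?thesis using right[of r] down that by simp
  qed
  have max: "f r \<le> f m" if "r \<in> {0..n}" for r
    using less[OF that] by (cases "r = m") auto
  have "m \<in> {0..n}" using m by simp
  then have "is_arg_max f (\<lambda>r. r \<in> {0..n}) m"
    using max unfolding is_arg_max_def by (blast dest: leD)
  moreover have "r = m" if "is_arg_max f (\<lambda>r. r \<in> {0..n}) r" for r
    using that less[of r] \<open>m \<in> {0..n}\<close> unfolding is_arg_max_def by blast
  ultimately show ?thesis by blast
qed

lemma deviation_le_sup_deviation:
  assumes "u \<in> K" "r \<in> {1..n}" "l * real_of_int n + u = real_of_int r"
  shows "\<bar>D n r - g u\<bar> \<le> sup_deviation D l g K n"
proof -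
  let ?S = "{\<bar>D n r - g u\<bar> | u r. u \<in> K \<and> r \<in> {1..n} \<and> l * real_of_int n + u = real_of_int r}"
  \<comment> \<open>The lattice equation determines \<open>u\<close> from \<open>r\<close>, so there
    are at most as many deviations as indices \<open>r\<close>. This bounds them for every
    \<open>K\<close> and \<open>g\<close>.\<close>
  have "?S \<subseteq> (\<lambda>r. \<bar>D n r - g (real_of_int r - l * real_of_int n)\<bar>) ` {1..n}"
  proof
    fix y assume "y \<in> ?S"
    then obtain u r where y: "y = \<bar>D n r - g u\<bar>" and r: "r \<in> {1..n}"
      and "l * real_of_int n + u = real_of_int r" by blast
    then have "u = real_of_int r - l * real_of_int n" by linarith
    with y r show "y \<in> (\<lambda>r. \<bar>D n r - g (real_of_int r - l * real_of_int n)\<bar>) ` {1..n}" by blast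
  qed
  then have "finite ?S" by (rule finite_subset) simp
  then have bdd: "bdd_above ?S" by (rule bdd_above_finite)
  have mem: "\<bar>D n r - g u\<bar> \<in> ?S" using assms by blast
  have "\<bar>D n r - g u\<bar> \<le> Sup ?S" by (rule cSup_upper[OF mem bdd])
  \<comment> \<open>The given pair \<open>u\<close>, \<open>r\<close> makes the set nonempty, so the
    default value 0 does not enter.\<close>
  moreover have "sup_deviation D l g K n = Sup ?S"
    unfolding sup_deviation_def Sup0_def by (rule if_not_P) (use mem in blast)
  ultimately show ?thesis by simp
qed

text \<open>Up to a convergent term, \<open>r j\<close> is \<open>l * q j\<close> and
  \<open>q j - r j\<close> is \<open>(1 - l) * q j\<close>. As 0 < \<open>l\<close> < 1, both tend
  to infinity, so \<open>r j\<close> eventually stays away from both ends of the range.\<close>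

lemma eventually_lattice_index_admissible:
  fixes q r :: "nat \<Rightarrow> int"
  assumes l: "l \<in> {0<..<1}"
    and q: "filterlim q at_top sequentially"
    and r: "(\<lambda>j. real_of_int (r j) - l * real_of_int (q j)) \<longlonglongrightarrow> x"
  shows "\<forall>\<^sub>F j in sequentially. r j \<in> {1..q j}"
proof -
  have qr: "filterlim (\<lambda>j. real_of_int (q j)) at_top sequentially"
    by (rule filterlim_compose[OF filterlim_real_of_int_at_top q])
  have "filterlim (\<lambda>j. l * real_of_int (q j)) at_top sequentially"
    by (rule filterlim_tendsto_pos_mult_at_top[OF tendsto_const _ qr]) (use l in simp)
  from filterlim_tendsto_add_at_top[OF r this]
  have "filterlim (\<lambda>j. real_of_int (r j)) at_top sequentially" by simp
  then have low: "\<forall>\<^sub>F j in sequentially. 1 \<le> real_of_int (r j)"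
    unfolding filterlim_at_top by blast
  have "filterlim (\<lambda>j. (1 - l) * real_of_int (q j)) at_top sequentially"
    by (rule filterlim_tendsto_pos_mult_at_top[OF tendsto_const _ qr]) (use l in simp)
  from filterlim_tendsto_add_at_top[OF tendsto_minus[OF r] this]
  have "filterlim (\<lambda>j. real_of_int (q j) - real_of_int (r j)) at_top sequentially"
    by (simp add: algebra_simps)
  then have high: "\<forall>\<^sub>F j in sequentially. 0 \<le> real_of_int (q j) - real_of_int (r j)"
    unfolding filterlim_at_top by blast
  from low high show ?thesis by eventually_elim auto
qed

text \<open>The offset \<open>u j = r j - l * q j\<close> varies with \<open>j\<close>, so the
  deviation must be controlled uniformly near \<open>x\<close>. A closed ball around
  \<open>x\<close> inside \<open>U\<close> serves as the compact set and eventually contains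
  \<open>u j\<close>; continuity of \<open>g\<close> then replaces \<open>g (u j)\<close> by
  \<open>g x\<close>.\<close>

lemma locally_uniform_lattice_limit_tendsto:
  fixes q r :: "nat \<Rightarrow> int"
  assumes l: "l \<in> {0<..<1}"
    and U: "open U" "x \<in> U"
    and g: "continuous_on U g"
    and lim: "locally_uniform_lattice_limit D l g U"
    and q: "filterlim q at_top sequentially"
    and r: "(\<lambda>j. real_of_int (r j) - l * real_of_int (q j)) \<longlonglongrightarrow> x"
  shows "(\<lambda>j. D (q j) (r j)) \<longlonglongrightarrow> g x"
proof -
  define u where "u j = real_of_int (r j) - l * real_of_int (q j)" for j
  have u: "u \<longlonglongrightarrow> x" using r unfolding u_def .
  obtain e where e: "e > 0" "cball x e \<subseteq> U"
    using U open_contains_cball by blast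
  have "(sup_deviation D l g (cball x e) \<longlongrightarrow> 0) at_top"
    using lim e(2) compact_cball[of x e] unfolding locally_uniform_lattice_limit_def by simp
  from filterlim_compose[OF this q]
  have dev: "(\<lambda>j. sup_deviation D l g (cball x e) (q j)) \<longlonglongrightarrow> 0" .
  have "\<forall>\<^sub>F j in sequentially. u j \<in> ball x e"
    using u e by (intro topological_tendstoD) auto
  with eventually_lattice_index_admissible[OF l q r]
  have "\<forall>\<^sub>F j in sequentially.
      norm (D (q j) (r j) - g (u j)) \<le> sup_deviation D l g (cball x e) (q j)"
  proof eventually_elim
    case (elim j)
    then show ?case
      unfolding real_norm_def by (intro deviation_le_sup_deviation) (auto simp: u_def)
  qed
  then have diff: "(\<lambda>j. D (q j) (r j) - g (u j)) \<longlonglongrightarrow> 0"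
    by (rule Lim_null_comparison[OF _ dev])
  have "isCont g x"
    using g U by (simp add: continuous_on_eq_continuous_at)
  then have "(\<lambda>j. g (u j)) \<longlonglongrightarrow> g x"
    using u by (rule isCont_tendsto_compose)
  from tendsto_add[OF diff this] show ?thesis by simp
qed

theorem mainTheorem4:
  fixes V :: "int \<Rightarrow> int \<Rightarrow> real"
    and k :: "int \<Rightarrow> real"
    and l :: real
    and U :: "real set"
    and g :: "real \<Rightarrow> real"
    and p q :: "nat \<Rightarrow> int"
    and s :: real
    and h :: int
  assumes "\<And>n. n \<ge> 1 \<Longrightarrow> unimodal_upto n (V n)"
    and "\<And>n. n \<ge> 1 \<Longrightarrow> k n > 0"
    and "l \<in> {0<..<1}"
    and "open U" and "is_interval U"
    and "continuous_on U g"
    and "locally_uniform_lattice_limit (scaled_Delta k V) l g U"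
    and "filterlim q at_top sequentially"
    and "(\<lambda>j. real_of_int (p j) - l * real_of_int (q j)) \<longlonglongrightarrow> s"
    and "s + real_of_int h \<in> U" and "s + real_of_int h + 1 \<in> U"
    and "g (s + real_of_int h) > 0" and "0 > g (s + real_of_int h + 1)"
  shows "\<forall>\<^sub>F j in sequentially.
           {r. is_arg_max (V (q j)) (\<lambda>r. r \<in> {0..q j}) r} = {p j + h}"
proof -
  let ?D = "scaled_Delta k V"
  have p_up: "(\<lambda>j. real_of_int (p j + h) - l * real_of_int (q j)) \<longlonglongrightarrow> s + real_of_int h"
    using tendsto_add[OF assms(9) tendsto_const[of "real_of_int h"]] by (simp add: algebra_simps)
  have p_down: "(\<lambda>j. real_of_int (p j + h + 1) - l * real_of_int (q j)) \<longlonglongrightarrow> s + real_of_int h + 1"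
    using tendsto_add[OF p_up tendsto_const[of 1]] by (simp add: algebra_simps)
  have "(\<lambda>j. ?D (q j) (p j + h)) \<longlonglongrightarrow> g (s + real_of_int h)"
    by (rule locally_uniform_lattice_limit_tendsto[OF assms(3,4,10,6,7,8) p_up])
  then have up: "\<forall>\<^sub>F j in sequentially. ?D (q j) (p j + h) > 0"
    using assms(12) by (rule order_tendstoD(1))
  have "(\<lambda>j. ?D (q j) (p j + h + 1)) \<longlonglongrightarrow> g (s + real_of_int h + 1)"
    by (rule locally_uniform_lattice_limit_tendsto[OF assms(3,4,11,6,7,8) p_down])
  then have down: "\<forall>\<^sub>F j in sequentially. ?D (q j) (p j + h + 1) < 0"
    using assms(13) by (rule order_tendstoD(2))
  \<comment> \<open>Admissibility is used at both indices: \<open>p j + h \<ge> 1\<close> and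
    \<open>p j + h + 1 \<le> q j\<close> place the candidate strictly inside the range, with both
    neighbours in {0..\<open>q j\<close>}.\<close>
  from up down eventually_lattice_index_admissible[OF assms(3,8) p_up]
    eventually_lattice_index_admissible[OF assms(3,8) p_down]
  show ?thesis
  proof eventually_elim
    case (elim j)
    have n: "q j \<ge> 1" using elim by simp
    \<comment> \<open>Since \<open>k (q j)\<close> is positive, the scaled difference has the sign
      of the difference itself, whatever the size of the factor.\<close>
    have "V (q j) (p j + h - 1) < V (q j) (p j + h)"
      using elim(1) assms(2)[OF n]
      by (simp add: scaled_Delta_def Delta_def zero_less_mult_iff)
    moreover have "V (q j) (p j + h + 1) < V (q j) (p j + h)"
      using elim(2) assms(2)[OF n]
      by (simp add: scaled_Delta_def Delta_def mult_less_0_iff)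
    ultimately show ?case
      using elim by (intro unimodal_upto_strict_local_max_unique assms(1) n) auto
  qed
qed

end
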